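(* Let $n \ge 1$ and let $P, Q \in \mathcal{H}_n$ be such that $P \preccurlyeq Q$. Then $P + \lambda P' \preccurlyeq Q + \lambda Q'$ for every $\lambda \in \mathbb{R}$.
   Context: $\mathcal{H}_n$ denotes the set of monic hyperbolic polynomials of degree $n$, i.e. monic polynomials of degree $n$ all of whose zeros are real. For a polynomial $P$ of degree $n$, $Z(P)$ is the unordered $n$-tuple of its zeros, each repeated according to multiplicity. For two unordered $n$-tuples $X=(x_1,\dots,x_n)$ and $Y=(y_1,\dots,y_n)$ of real numbers, $X \prec Y$ ($X$ is majorized by $Y$, or less than $Y$ in the spectral order) means that $\sum_{i=1}^n f(x_i) \le \sum_{i=1}^n f(y_i)$ for every convex function $f:\mathbb{R}\to\mathbb{R}$; equivalently, there is a doubly stochastic $n\times n$ matrix $A$ with $(x_1,\dots,x_n)^t = A (y_1,\dots,y_n)^t$. For $P,Q\in\mathcal{H}_n$, $P \preccurlyeq Q$ means $Z(P) \prec Z(Q)$. By the Hermite–Poulain theorem, $P+\lambda P' \in \mathcal{H}_n$ whenever $P\in\mathcal{H}_n$ and $\lambda\in\mathbb{R}$. *)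

theory Defs
  imports
    "HOL-Analysis.Analysis"
    "HOL-Computational_Algebra.Computational_Algebra"
begin

(* The zeros are taken in the complex plane. A monic complex polynomial all of whose zeros are
   real has real coefficients, so nothing is lost by working with real polynomials. *)
definition hyperbolic_polys :: "nat \<Rightarrow> real poly set" where
  "hyperbolic_polys n =
     {P. degree P = n \<and> lead_coeff P = 1 \<and>
         (\<forall>z::complex. poly (map_poly complex_of_real P) z = 0 \<longrightarrow> z \<in> \<real>)}"

definition majorized :: "real multiset \<Rightarrow> real multiset \<Rightarrow> bool"  (infix "\<prec>\<^sub>m" 50) where
  "X \<prec>\<^sub>m Y \<longleftrightarrow>
     size X = size Y \<and>
     (\<forall>f::real \<Rightarrow> real. convex_on UNIV f \<longrightarrow> (\<Sum>x\<in>#X. f x) \<le> (\<Sum>y\<in>#Y. f y))"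

(* proots P holds only the real zeros of P (with multiplicity); these are all n zeros because
   P is hyperbolic, see size_proots_hyperbolic below. The relation lives on the hyperbolic
   polynomials of degree n, hence the membership conditions. *)
definition spectral_le :: "nat \<Rightarrow> real poly \<Rightarrow> real poly \<Rightarrow> bool" where
  "spectral_le n P Q \<longleftrightarrow>
     P \<in> hyperbolic_polys n \<and> Q \<in> hyperbolic_polys n \<and> proots P \<prec>\<^sub>m proots Q"

lemma size_proots_hyperbolic:
  assumes "P \<in> hyperbolic_polys n"
  shows "size (proots P) = n"
  using assms
proof (induction n arbitrary: P)
  case 0
  then have "degree P = 0" by (simp add: hyperbolic_polys_def)
  then obtain c where "P = [:c:]" by (rule degree_eq_zeroE)
  then show ?case by simp
next
  case (Suc n)
  let ?c = "map_poly complex_of_real"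
  have deg: "degree P = Suc n" and lc: "lead_coeff P = 1"
    and real: "\<And>z. poly (?c P) z = 0 \<Longrightarrow> z \<in> \<real>"
    using Suc.prems by (auto simp: hyperbolic_polys_def)
  have "degree (?c P) = Suc n" using deg by (subst degree_map_poly) auto
  then have "\<not> constant (poly (?c P))" by (simp add: constant_degree)
  then obtain z where z: "poly (?c P) z = 0"
    using fundamental_theorem_of_algebra by blast
  then obtain r where r: "z = of_real r" using real Reals_cases by blast
  have "complex_of_real (poly P r) = poly (?c P) (of_real r)"
    by (simp add: poly_altdef degree_map_poly coeff_map_poly)
  then have "poly P r = 0" using z r by simp
  then obtain R where R: "P = [:- r, 1:] * R" by (metis poly_eq_0_iff_dvd dvdE)
  have R0: "R \<noteq> 0" using R deg by auto
  have "degree P = degree [:- r, 1:] + degree R"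
    unfolding R using R0 by (intro degree_mult_eq) auto
  then have degR: "degree R = n" using deg by simp
  have lcR: "lead_coeff R = 1" using lc unfolding R by (simp add: lead_coeff_mult del: mult_pCons_left)
  have "?c P = ?c [:- r, 1:] * ?c R"
    unfolding R by (rule poly_eqI) (simp add: coeff_map_poly coeff_mult del: mult_pCons_left)
  then have "R \<in> hyperbolic_polys n"
    using degR lcR real by (auto simp: hyperbolic_polys_def)
  then have "size (proots R) = n" by (rule Suc.IH)
  moreover have "proots P = proots [:- r, 1:] + proots R"
    unfolding R using R0 by (intro proots_mult) auto
  ultimately show ?case by simp
qed

end

theory Submission
  imports Defs
begin

text \<open>
  A pinch replaces two members \<open>a \<le> b\<close> of a multiset by two numbers \<open>a' \<le> b'\<close> between them with the
  same sum. By Hardy, Littlewood and Polya, \<open>X\<close> is majorized by \<open>Y\<close> only if \<open>X\<close> is obtained from \<open>Y\<close> by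
  finitely many pinches (\<open>majorized_pinch_induct\<close>). As majorization is a preorder, it suffices to
  consider \<open>Q\<close> with roots \<open>a, b\<close> and further roots \<open>M\<close>, and \<open>P\<close> with roots \<open>a', b'\<close> and the same
  further roots. For \<open>c = 0\<close> there is nothing to prove, so let \<open>c \<noteq> 0\<close>.

  Let \<open>m\<close> be the common midpoint of the two pairs. The claim is that the new roots \<open>w\<close> of \<open>P + c P'\<close>, compared
  in increasing order with the new roots \<open>u\<close> of \<open>Q + c Q'\<close>, are all closer to \<open>m\<close> on the same side:
  each \<open>w\<close> lies between \<open>m\<close> and its \<open>u\<close>. Infinitesimally this is seen from the equation
  \<open>\<Sum>i. 1 / (w - x\<^sub>i) = - 1 / c\<close>: it shows that \<open>w\<close> follows the root \<open>x\<^sub>i\<close> at a rate proportional to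
  \<open>1 / (w - x\<^sub>i)\<^sup>2\<close>, so that the nearer of \<open>a\<close> and \<open>b\<close>, the one on the side of \<open>w\<close>, wins when the two
  approach each other. As the sum of the new roots is also preserved, subtracting from
  a convex function its supporting line at \<open>m\<close> gives majorization
  (\<open>majorized_if_single_crossing\<close>).

  The claim is proved without derivatives in the roots, by counting the new roots on either side of
  a threshold \<open>t\<close>. Rolle's theorem for \<open>exp (x / c) * P x\<close> shows that the number of roots beyond \<open>t\<close>, in the
  direction of \<open>- c\<close>, grows by 0 or 1 in the passage from \<open>P\<close> to \<open>P + c P'\<close>. Parity shows that it grows
  exactly if \<open>P\<close> and \<open>P + c P'\<close> have opposite signs at \<open>t\<close> (\<open>count_roots_hermite_poulain\<close>), that is, if
  \<open>1 + c * (\<Sum>i. 1 / (t - x\<^sub>i))\<close> is negative. How this condition reacts to a pinch is visible from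
  \<open>1 / (t - a) + 1 / (t - b) = 2 (t - m) / ((t - a) (t - b))\<close>, and depends only on
  the side of \<open>m\<close> on which \<open>t\<close> lies (\<open>pinch_count\<close>).
\<close>

section \<open>Majorization by pinching\<close>

lemma majorized_refl: "X \<prec>\<^sub>m X"
  by (simp add: majorized_def)

lemma majorized_trans: "X \<prec>\<^sub>m Y \<Longrightarrow> Y \<prec>\<^sub>m Z \<Longrightarrow> X \<prec>\<^sub>m Z"
  unfolding majorized_def by (metis order_trans)

text \<open>
  The Hardy--Littlewood--Polya decomposition, by induction on the number of positions at which
  \<open>x\<close> and \<open>y\<close> differ. If some entry of \<open>y\<close> is too large, the first such position \<open>k\<close> is preceded
  by a position where \<open>y\<close> is too small, since partial sums of \<open>y\<close> never exceed those of \<open>x\<close>.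
  With \<open>j\<close> the last of these, both sequences agree strictly between \<open>j\<close> and \<open>k\<close>. Moving \<open>y j\<close> up
  and \<open>y k\<close> down by the largest amount \<open>e\<close> that overshoots neither target makes one more position
  agree, keeps \<open>y\<close> sorted because the two new values are separated by \<open>x j \<le> x k\<close>, and keeps
  the partial sum condition because \<open>y \<le> x\<close> on all positions before \<open>k\<close>.
\<close>
lemma sorted_partial_sums_pinch_induct:
  fixes x y :: "nat \<Rightarrow> real" and R :: "real multiset \<Rightarrow> real multiset \<Rightarrow> bool"
  assumes refl: "\<And>X. R X X" and trans: "\<And>X Y Z. R X Y \<Longrightarrow> R Y Z \<Longrightarrow> R X Z"
    and pinch: "\<And>a b a' b' M. a \<le> a' \<Longrightarrow> a' \<le> b' \<Longrightarrow> b' \<le> b \<Longrightarrow> a' + b' = a + b \<Longrightarrow>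
                  R ({#a', b'#} + M) ({#a, b#} + M)"
    and x: "\<And>i j. i \<le> j \<Longrightarrow> j < n \<Longrightarrow> x i \<le> x j"
  shows "(\<And>i j. i \<le> j \<Longrightarrow> j < n \<Longrightarrow> y i \<le> y j) \<Longrightarrow>
         (\<And>k. k \<le> n \<Longrightarrow> (\<Sum>i<k. y i) \<le> (\<Sum>i<k. x i)) \<Longrightarrow> (\<Sum>i<n. y i) = (\<Sum>i<n. x i) \<Longrightarrow>
         R (image_mset x (mset_set {..<n})) (image_mset y (mset_set {..<n}))"
proof (induction "card {i. i < n \<and> x i \<noteq> y i}" arbitrary: y rule: less_induct)
  case less
  note y = less.prems(1) and le = less.prems(2) and eq = less.prems(3)
  let ?m = "\<lambda>z. image_mset z (mset_set {..<n})"
  show ?case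
  proof (cases "\<exists>k<n. x k < y k")
    case False
    have "x i = y i" if "i < n" for i
    proof (rule ccontr)
      assume "x i \<noteq> y i"
      then have "y i < x i" using False that by force
      moreover have "\<forall>k\<in>{..<n}. y k \<le> x k" using False by (meson lessThan_iff not_less)
      ultimately have "(\<Sum>i<n. y i) < (\<Sum>i<n. x i)"
        using that by (intro sum_strict_mono_ex1) auto
      then show False using eq by simp
    qed
    then have "?m x = ?m y" by (intro image_mset_cong) auto
    then show ?thesis using refl by simp
  next
    case True
    define k where "k = (LEAST k. k < n \<and> x k < y k)"
    have k: "k < n" "x k < y k" using LeastI_ex[OF True] by (auto simp: k_def)
    have least: "y i \<le> x i" if "i < k" for i
      using not_less_Least[of i "\<lambda>k. k < n \<and> x k < y k"] that k(1) by (force simp: k_def)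
    have "\<exists>i<k. y i < x i"
    proof (rule ccontr)
      assume "\<not> ?thesis"
      then have "(\<Sum>i<k. x i) \<le> (\<Sum>i<k. y i)" by (intro sum_mono) (meson lessThan_iff not_less)
      then have "(\<Sum>i<Suc k. x i) < (\<Sum>i<Suc k. y i)" using k(2) by simp
      then show False using le[of "Suc k"] k(1) by simp
    qed
    then have neJ: "{i. i < k \<and> y i < x i} \<noteq> {}" by auto
    define j where "j = Max {i. i < k \<and> y i < x i}"
    have j: "j < k" "y j < x j" using Max_in[OF _ neJ] by (auto simp: j_def)
    have mid: "y i = x i" if "j < i" "i < k" for i
    proof (rule ccontr)
      assume "y i \<noteq> x i"
      then have "i \<in> {i. i < k \<and> y i < x i}" using least[of i] that by auto
      then have "i \<le> j" unfolding j_def by (intro Max_ge) auto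
      then show False using that by simp
    qed
    define e where "e = min (x j - y j) (y k - x k)"
    have e: "e > 0" "y j + e \<le> x j" "x k \<le> y k - e" "e = x j - y j \<or> e = y k - x k"
      using j k by (auto simp: e_def min_def)
    define y' where "y' = y(j := y j + e, k := y k - e)"
    have y'j: "y' j = y j + e" and y'k: "y' k = y k - e" and y'o: "i \<noteq> j \<Longrightarrow> i \<noteq> k \<Longrightarrow> y' i = y i" for i
      using j by (auto simp: y'_def)
    have xjk: "x j \<le> x k" using x[of j k] j k by simp
    have mono': "y' i \<le> y' l" if "i \<le> l" "l < n" for i l
    proof -
      have yil: "y i \<le> y l" by (rule y[OF that])
      have "y' i \<le> y' l" if "i < l"
      proof -
        consider "i = j" "l < k" | "i = j" "l = k" | "i = j" "l > k" | "i = k"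
          | "i \<noteq> j" "i \<noteq> k" "l = j" | "i < j" "l = k" | "j < i" "l = k"
          | "i \<noteq> j" "i \<noteq> k" "l \<noteq> j" "l \<noteq> k"
          using \<open>i < l\<close> by linarith
        then show ?thesis
        proof cases
          case 1
          then show ?thesis using mid[of l] x[of j l] \<open>i < l\<close> \<open>l < n\<close> y'j y'o[of l] e j by simp
        next
          case 2
          then show ?thesis using y'j y'k e xjk by simp
        next
          case 3
          have "y k \<le> y l" using y[of k l] 3 \<open>l < n\<close> by simp
          then show ?thesis using y'j y'o[of l] e xjk 3 j by simp
        next
          case 4
          then show ?thesis using y'k y'o[of l] e yil j \<open>i < l\<close> by simp
        next
          case 5
          then show ?thesis using y'j y'o[of i] e yil by simp
        next
          case 6
          have "y i \<le> y j" using y[of i j] 6 j k by simp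
          then show ?thesis using y'k y'o[of i] e xjk 6 j by simp
        next
          case 7
          then show ?thesis using mid[of i] x[of i k] \<open>i < l\<close> k y'k y'o[of i] e by simp
        next
          case 8
          then show ?thesis using y'o yil by simp
        qed
      qed
      then show ?thesis using \<open>i \<le> l\<close> by (cases "i = l") auto
    qed
    have sums: "(\<Sum>i<q. y' i) = (\<Sum>i<q. y i) + (if j < q then e else 0) - (if k < q then e else 0)" for q
    proof -
      have "(\<Sum>i<q. y' i) = (\<Sum>i<q. y i + (if i = j then e else 0) - (if i = k then e else 0))"
        using j by (intro sum.cong) (auto simp: y'_def)
      then show ?thesis by (simp add: sum.distrib sum_subtractf)
    qed
    have le': "(\<Sum>i<q. y' i) \<le> (\<Sum>i<q. x i)" if q: "q \<le> n" for q
    proof (cases "j < q \<and> q \<le> k")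
      case True
      have "y i + (if i = j then e else 0) \<le> x i" if "i < q" for i
        using e(2) least[of i] True that by auto
      then have "(\<Sum>i<q. y i + (if i = j then e else 0)) \<le> (\<Sum>i<q. x i)"
        by (intro sum_mono) auto
      then show ?thesis using True by (simp add: sums sum.distrib)
    next
      case False
      then show ?thesis using le[OF q] e(1) j by (auto simp: sums)
    qed
    have eq': "(\<Sum>i<n. y' i) = (\<Sum>i<n. x i)" using eq j k by (simp add: sums)
    have "{i. i < n \<and> x i \<noteq> y' i} \<subset> {i. i < n \<and> x i \<noteq> y i}"
    proof
      show "{i. i < n \<and> x i \<noteq> y' i} \<subseteq> {i. i < n \<and> x i \<noteq> y i}"
        using j k by (auto simp: y'_def split: if_splits)
      have "j \<in> {i. i < n \<and> x i \<noteq> y i}" "k \<in> {i. i < n \<and> x i \<noteq> y i}" using j k by auto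
      moreover have "j \<notin> {i. i < n \<and> x i \<noteq> y' i} \<or> k \<notin> {i. i < n \<and> x i \<noteq> y' i}"
        using e(4) y'j y'k by auto
      ultimately show "{i. i < n \<and> x i \<noteq> y' i} \<noteq> {i. i < n \<and> x i \<noteq> y i}" by blast
    qed
    then have "card {i. i < n \<and> x i \<noteq> y' i} < card {i. i < n \<and> x i \<noteq> y i}"
      by (intro psubset_card_mono) auto
    then have "R (?m x) (?m y')" by (rule less.hyps) (rule mono' le' eq'; assumption)+
    moreover have "R (?m y') (?m y)"
    proof -
      let ?I = "{..<n} - {j, k}"
      have dec: "mset_set {..<n} = {#j, k#} + mset_set ?I"
      proof -
        have "{..<n} = insert j (insert k ?I)" using j k by auto
        also have "mset_set \<dots> = add_mset j (mset_set (insert k ?I))"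
          using j by (intro mset_set.insert) auto
        also have "mset_set (insert k ?I) = add_mset k (mset_set ?I)"
          by (intro mset_set.insert) auto
        finally show ?thesis by simp
      qed
      have "image_mset y' (mset_set ?I) = image_mset y (mset_set ?I)"
        by (intro image_mset_cong) (auto simp: y'_def)
      then show ?thesis unfolding dec
        using pinch[of "y j" "y' j" "y' k" "y k" "image_mset y (mset_set ?I)"] y'j y'k e xjk by simp
    qed
    ultimately show ?thesis by (rule trans)
  qed
qed

lemma convex_on_hinge: "convex_on UNIV (\<lambda>t::real. max 0 (s - t))"
proof (rule convex_onI)
  fix t x y :: real assume t: "0 < t" "t < 1"
  have "(1 - t) * (s - x) \<le> (1 - t) * max 0 (s - x)" "t * (s - y) \<le> t * max 0 (s - y)"
    using t by (intro mult_left_mono; simp)+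
  moreover have "0 \<le> (1 - t) * max 0 (s - x)" "0 \<le> t * max 0 (s - y)"
    using t by (intro mult_nonneg_nonneg; simp)+
  moreover have "s - ((1 - t) *\<^sub>R x + t *\<^sub>R y) = (1 - t) * (s - x) + t * (s - y)"
    by (simp add: algebra_simps)
  ultimately show "max 0 (s - ((1 - t) *\<^sub>R x + t *\<^sub>R y)) \<le> (1 - t) * max 0 (s - x) + t * max 0 (s - y)"
    by linarith
qed simp

lemma majorized_sum_eq:
  assumes "X \<prec>\<^sub>m Y"
  shows "sum_mset X = sum_mset Y"
proof (rule antisym)
  have cvx: "convex_on UNIV (\<lambda>x::real. x)" "convex_on UNIV (\<lambda>x::real. - x)"
    by (auto intro!: convex_onI simp: algebra_simps)
  have "(\<Sum>x\<in>#X. x) \<le> (\<Sum>y\<in>#Y. y)" using assms cvx(1) unfolding majorized_def by blast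
  then show "sum_mset X \<le> sum_mset Y" by simp
  have "(\<Sum>x\<in>#X. - x) \<le> (\<Sum>y\<in>#Y. - y)" using assms cvx(2) unfolding majorized_def by blast
  moreover have "(\<Sum>x\<in>#M. - x) = - sum_mset M" for M :: "real multiset"
    by (induction M) auto
  ultimately show "sum_mset Y \<le> sum_mset X" by simp
qed

text \<open>
  With the hinge function bent at the \<open>k\<close>-th smallest entry \<open>s\<close> of \<open>ys\<close>, the sum over \<open>ys\<close> is exactly
  \<open>\<Sum>i<k. s - ys ! i\<close>, whereas the sum over \<open>xs\<close> is at least \<open>\<Sum>i<k. s - xs ! i\<close>.
\<close>
lemma majorized_partial_sums:
  assumes maj: "mset xs \<prec>\<^sub>m mset ys" and sorted: "sorted ys" and k: "k \<le> length ys"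
  shows "(\<Sum>i<k. ys ! i) \<le> (\<Sum>i<k. xs ! i)"
proof (cases k)
  case (Suc l)
  let ?h = "\<lambda>t. max 0 (ys ! l - t)"
  have len: "length xs = length ys" using maj by (simp add: majorized_def)
  have "(\<Sum>x\<in>#mset xs. ?h x) \<le> (\<Sum>y\<in>#mset ys. ?h y)"
    using maj convex_on_hinge unfolding majorized_def by blast
  then have main: "(\<Sum>i<length ys. ?h (xs ! i)) \<le> (\<Sum>i<length ys. ?h (ys ! i))"
    using len by (simp add: sum_mset_sum_list sum_list_sum_nth atLeast0LessThan flip: mset_map)
  have "(\<Sum>i<k. ys ! l - xs ! i) \<le> (\<Sum>i<k. ?h (xs ! i))" by (intro sum_mono) simp
  also have "\<dots> \<le> (\<Sum>i<length ys. ?h (xs ! i))" using k by (intro sum_mono2) auto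
  also note main
  also have "(\<Sum>i<length ys. ?h (ys ! i)) = (\<Sum>i<k. ?h (ys ! i))"
    using k sorted Suc by (intro sum.mono_neutral_right) (auto simp: sorted_iff_nth_mono)
  also have "\<dots> = (\<Sum>i<k. ys ! l - ys ! i)"
    using k sorted Suc by (intro sum.cong) (auto simp: sorted_iff_nth_mono)
  finally show ?thesis by (simp add: sum_subtractf)
qed simp

text \<open>
  Thus majorization is the smallest preorder that contains all pinches, and a property of pairs of
  multisets that is a preorder needs to be verified for pinches only.
\<close>
theorem majorized_pinch_induct:
  fixes R :: "real multiset \<Rightarrow> real multiset \<Rightarrow> bool"
  assumes "X \<prec>\<^sub>m Y"
    and refl: "\<And>X. R X X" and trans: "\<And>X Y Z. R X Y \<Longrightarrow> R Y Z \<Longrightarrow> R X Z"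
    and pinch: "\<And>a b a' b' M. a \<le> a' \<Longrightarrow> a' \<le> b' \<Longrightarrow> b' \<le> b \<Longrightarrow> a' + b' = a + b \<Longrightarrow>
                  R ({#a', b'#} + M) ({#a, b#} + M)"
  shows "R X Y"
proof -
  define xs where "xs = sorted_list_of_multiset X"
  define ys where "ys = sorted_list_of_multiset Y"
  have xs: "sorted xs" "mset xs = X" and ys: "sorted ys" "mset ys = Y"
    by (simp_all add: xs_def ys_def)
  let ?n = "length ys"
  have maj: "mset xs \<prec>\<^sub>m mset ys" using assms(1) xs ys by simp
  have len: "length xs = ?n" using maj by (simp add: majorized_def)
  have mset: "image_mset ((!) zs) (mset_set {..<length zs}) = mset zs" for zs :: "real list"
    by (metis atLeast_upt map_nth mset_map mset_upt lessThan_atLeast0)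
  have total: "(\<Sum>i<?n. ys ! i) = (\<Sum>i<?n. xs ! i)"
    using majorized_sum_eq[OF maj] len
    by (simp add: sum_mset_sum_list sum_list_sum_nth atLeast0LessThan)
  have "R (image_mset ((!) xs) (mset_set {..<?n})) (image_mset ((!) ys) (mset_set {..<?n}))"
    by (rule sorted_partial_sums_pinch_induct[of R, OF refl trans pinch _ _ _ total])
       (use xs ys len majorized_partial_sums[OF maj ys(1)] in \<open>auto simp: sorted_iff_nth_mono\<close>)
  then show ?thesis using mset[of xs] mset[of ys] len xs ys by simp
qed

section \<open>Majorization from a single crossing of root counts\<close>

text \<open>
  Once a supporting line at \<open>m\<close> is subtracted, a convex function has its minimum at \<open>m\<close> and
  therefore grows along every ray that starts there.
\<close>
lemma convex_shifted_mono_from_center: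
  fixes f :: "real \<Rightarrow> real"
  assumes f: "convex_on UNIV f" and d: "\<And>y. f m + d * (y - m) \<le> f y"
    and w: "w \<in> closed_segment m u"
  shows "f w - d * w \<le> f u - d * u"
proof -
  obtain s where s: "0 \<le> s" "s \<le> 1" "w = (1 - s) * m + s * u"
    using w unfolding closed_segment_def real_scaleR_def by blast
  have "f ((1 - s) *\<^sub>R m + s *\<^sub>R u) \<le> (1 - s) * f m + s * f u"
    by (rule convex_onD[OF f s(1,2)]) simp_all
  then have "f w \<le> (1 - s) * f m + s * f u" unfolding s(3) real_scaleR_def .
  moreover have "0 \<le> (1 - s) * (f u - (f m + d * (u - m)))"
    using d[of u] s(2) by (intro mult_nonneg_nonneg) simp_all
  moreover have "(f u - d * u) - (((1 - s) * f m + s * f u) - d * w)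
      = (1 - s) * (f u - (f m + d * (u - m)))"
    unfolding s(3) by algebra
  ultimately show ?thesis by linarith
qed

lemma count_greater_sorted_ge:
  assumes "sorted xs" "k < length xs" "t < xs ! k"
  shows "length xs - k \<le> size (filter_mset (\<lambda>x. t < x) (mset xs))"
proof -
  have "t < x" if x: "x \<in> set (drop k xs)" for x
  proof -
    obtain i where "i < length (drop k xs)" "drop k xs ! i = x"
      using x unfolding in_set_conv_nth by blast
    moreover from this have "k + i < length xs" by simp
    ultimately show ?thesis using assms sorted_nth_mono[OF assms(1), of k "k + i"] by simp
  qed
  then have "filter (\<lambda>x. t < x) (drop k xs) = drop k xs" by (simp add: filter_id_conv)
  moreover have "filter (\<lambda>x. t < x) xs = filter (\<lambda>x. t < x) (take k xs) @ filter (\<lambda>x. t < x) (drop k xs)"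
    by (simp flip: filter_append)
  ultimately have "length (filter (\<lambda>x. t < x) xs) \<ge> length xs - k" by simp
  then show ?thesis by (simp flip: mset_filter)
qed

lemma count_greater_sorted_le:
  assumes "sorted xs" "k < length xs" "xs ! k \<le> t"
  shows "size (filter_mset (\<lambda>x. t < x) (mset xs)) < length xs - k"
proof -
  have "\<not> t < x" if x: "x \<in> set (take (Suc k) xs)" for x
  proof -
    obtain i where "i < length (take (Suc k) xs)" "take (Suc k) xs ! i = x"
      using x unfolding in_set_conv_nth by blast
    then show ?thesis using assms sorted_nth_mono[OF assms(1), of i k] by simp
  qed
  then have "filter (\<lambda>x. t < x) (take (Suc k) xs) = []" by (simp add: filter_empty_conv)
  moreover have "filter (\<lambda>x. t < x) xs
      = filter (\<lambda>x. t < x) (take (Suc k) xs) @ filter (\<lambda>x. t < x) (drop (Suc k) xs)"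
    by (simp flip: filter_append)
  ultimately have "length (filter (\<lambda>x. t < x) xs) \<le> length (drop (Suc k) xs)"
    by (simp del: length_drop)
  then have "length (filter (\<lambda>x. t < x) xs) < length xs - k" using assms(2) by simp
  then show ?thesis by (simp flip: mset_filter)
qed

text \<open>
  List both multisets in increasing order. The counting hypotheses say that every entry of \<open>W\<close> lies
  between \<open>m\<close> and the corresponding entry of \<open>U\<close>, so a convex function, minus its supporting line at
  \<open>m\<close>, is at least as large at the latter as at the former. The linear correction is the same on both sides because the sums agree.
  The finite set \<open>E\<close> of excluded thresholds does no harm: a violation at one threshold persists on a
  whole interval.
\<close>
lemma majorized_if_single_crossing:
  fixes W U :: "real multiset"
  assumes size: "size W = size U" and sum: "sum_mset W = sum_mset U" and fin: "finite E"
    and above: "\<And>t. t \<notin> E \<Longrightarrow> m < t \<Longrightarrow>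
                  size (filter_mset (\<lambda>x. t < x) W) \<le> size (filter_mset (\<lambda>x. t < x) U)"
    and below: "\<And>t. t \<notin> E \<Longrightarrow> t < m \<Longrightarrow>
                  size (filter_mset (\<lambda>x. t < x) U) \<le> size (filter_mset (\<lambda>x. t < x) W)"
  shows "W \<prec>\<^sub>m U"
  unfolding majorized_def
proof (intro conjI allI impI size)
  fix f :: "real \<Rightarrow> real" assume f: "convex_on UNIV f"
  define ws where "ws = sorted_list_of_multiset W"
  define us where "us = sorted_list_of_multiset U"
  have ws: "sorted ws" "mset ws = W" and us: "sorted us" "mset us = U"
    by (simp_all add: ws_def us_def)
  have len: "length ws = length us" using size by (simp flip: ws(2) us(2))
  have generic: "\<exists>t. t \<notin> E \<and> p < t \<and> t < q" if "p < q" for p q :: real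
  proof -
    have "infinite ({p<..<q} - E)" using that fin by (intro Diff_infinite_finite) auto
    then have "{p<..<q} - E \<noteq> {}" by (metis finite.emptyI)
    then show ?thesis by auto
  qed
  \<comment> \<open>The slope of a supporting line of f at m.\<close>
  define d where "d = Inf ((\<lambda>t. (f m - f t) / (m - t)) ` ({m<..} \<inter> UNIV))"
  have d: "f m + d * (y - m) \<le> f y" for y
    using convex_le_Inf_differential[OF f, of m y] unfolding d_def by simp
  have between: "ws ! k \<in> closed_segment m (us ! k)" if k: "k < length ws" for k
  proof -
    have "ws ! k \<le> us ! k" if "m < ws ! k"
    proof (rule ccontr)
      assume "\<not> ws ! k \<le> us ! k"
      with that have gap: "max m (us ! k) < ws ! k" by simp
      obtain t where t: "t \<notin> E" "m < t" "us ! k < t" "t < ws ! k"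
        using generic[OF gap] by auto
      have "length ws - k \<le> size (filter_mset (\<lambda>x. t < x) W)"
        using count_greater_sorted_ge[OF ws(1) k] t(4) ws(2) by simp
      moreover have "size (filter_mset (\<lambda>x. t < x) U) < length us - k"
        using count_greater_sorted_le[OF us(1), of k t] k len t(3) us(2) by simp
      ultimately show False using above[OF t(1,2)] len by linarith
    qed
    moreover have "us ! k \<le> ws ! k" if "ws ! k < m"
    proof (rule ccontr)
      assume "\<not> us ! k \<le> ws ! k"
      with that have gap: "ws ! k < min m (us ! k)" by simp
      obtain t where t: "t \<notin> E" "t < m" "t < us ! k" "ws ! k < t"
        using generic[OF gap] by auto
      have "length us - k \<le> size (filter_mset (\<lambda>x. t < x) U)"
        using count_greater_sorted_ge[OF us(1), of k t] k len t(3) us(2) by simp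
      moreover have "size (filter_mset (\<lambda>x. t < x) W) < length ws - k"
        using count_greater_sorted_le[OF ws(1) k, of t] t(4) ws(2) by simp
      ultimately show False using below[OF t(1,2)] len by linarith
    qed
    ultimately show ?thesis
      by (cases "ws ! k" m rule: linorder_cases) (auto simp: closed_segment_eq_real_ivl)
  qed
  let ?g = "\<lambda>x. f x - d * x"
  have "(\<Sum>x\<leftarrow>ws. ?g x) \<le> (\<Sum>x\<leftarrow>us. ?g x)"
    unfolding sum_list_sum_nth using len between
    by (auto intro!: sum_mono convex_shifted_mono_from_center[OF f d])
  then have "(\<Sum>x\<in>#W. ?g x) \<le> (\<Sum>x\<in>#U. ?g x)"
    unfolding ws(2)[symmetric] us(2)[symmetric] by (simp only: mset_map[symmetric] sum_mset_sum_list)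
  moreover have "(\<Sum>x\<in>#M. ?g x) = (\<Sum>x\<in>#M. f x) - d * sum_mset M" for M
    by (induction M) (auto simp: algebra_simps)
  ultimately show "(\<Sum>x\<in>#W. f x) \<le> (\<Sum>x\<in>#U. f x)"
    using sum by simp
qed

section \<open>Monic polynomials with given real roots\<close>

definition monic_of_roots :: "real multiset \<Rightarrow> real poly" where
  "monic_of_roots M = (\<Prod>x\<in>#M. [:- x, 1:])"

lemma monic_of_roots_simps [simp]:
  "monic_of_roots {#} = 1"
  "monic_of_roots (add_mset x M) = [:- x, 1:] * monic_of_roots M"
  by (simp_all add: monic_of_roots_def)

text \<open>
  Keeping linear factors unexpanded lets the facts about products of polynomials apply to them.
\<close>
declare mult_pCons_left [simp del]

lemma monic_of_roots_nz [simp]: "monic_of_roots M \<noteq> 0"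
  by (induction M) auto

lemma degree_monic_of_roots [simp]: "degree (monic_of_roots M) = size M"
  by (induction M) (auto simp: degree_mult_eq)

lemma lead_coeff_monic_of_roots: "lead_coeff (monic_of_roots M) = 1"
  by (induction M) (auto simp only: monic_of_roots_simps lead_coeff_mult lead_coeff_1, auto)

lemma proots_monic_of_roots [simp]: "proots (monic_of_roots M) = M"
  by (induction M) (auto simp: proots_mult)

lemma monic_of_roots_proots:
  "lead_coeff p = 1 \<Longrightarrow> size (proots p) = degree p \<Longrightarrow> monic_of_roots (proots p) = p"
proof (induction "degree p" arbitrary: p)
  case 0
  then show ?case by (auto elim!: degree_eq_zeroE simp: one_pCons)
next
  case (Suc n)
  then have "proots p \<noteq> {#}" "p \<noteq> 0" by auto
  from \<open>proots p \<noteq> {#}\<close> obtain x where "x \<in># proots p" by (rule multiset_nonemptyE)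
  then have "poly p x = 0" using \<open>p \<noteq> 0\<close> by simp
  then obtain q where q: "p = [:- x, 1:] * q" by (metis poly_eq_0_iff_dvd dvdE)
  have q0: "q \<noteq> 0" using q \<open>p \<noteq> 0\<close> by auto
  have rts: "proots p = add_mset x (proots q)" using q q0 by (simp add: proots_mult)
  have deg: "degree p = Suc (degree q)" using q q0 by (simp add: degree_mult_eq)
  have "lead_coeff q = 1" using Suc.prems(1) unfolding q lead_coeff_mult by simp
  then have "monic_of_roots (proots q) = q" using Suc rts deg by simp
  then show ?case using rts q by simp
qed

lemma poly_map_of_real_monic_of_roots:
  "poly (map_poly complex_of_real (monic_of_roots M)) z = (\<Prod>x\<in>#M. z - of_real x)"
proof (induction M)
  case (add x M)
  have "map_poly complex_of_real ([:- x, 1:] * monic_of_roots M)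
      = map_poly complex_of_real [:- x, 1:] * map_poly complex_of_real (monic_of_roots M)"
    by (rule poly_eqI) (simp only: coeff_map_poly coeff_mult of_real_0 of_real_sum of_real_mult)
  then have "poly (map_poly complex_of_real (monic_of_roots (add_mset x M))) z
      = poly (map_poly complex_of_real [:- x, 1:]) z * poly (map_poly complex_of_real (monic_of_roots M)) z"
    by (simp only: monic_of_roots_simps poly_mult)
  also have "poly (map_poly complex_of_real [:- x, 1:]) z = z - of_real x"
    by (simp add: map_poly_pCons)
  finally show ?case by (simp only: add.IH image_mset_add_mset prod_mset.add_mset)
qed simp

lemma monic_of_roots_hyperbolic: "monic_of_roots M \<in> hyperbolic_polys (size M)"
  unfolding hyperbolic_polys_def mem_Collect_eq
proof (intro conjI allI impI)
  fix z assume "poly (map_poly complex_of_real (monic_of_roots M)) z = 0"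
  then obtain x where "z = of_real x"
    unfolding poly_map_of_real_monic_of_roots by (auto simp: prod_mset_zero_iff)
  then show "z \<in> \<real>" by simp
qed (rule degree_monic_of_roots lead_coeff_monic_of_roots)+

lemma hyperbolic_polys_D:
  assumes "p \<in> hyperbolic_polys n"
  shows "lead_coeff p = 1" "degree p = n"
  using assms unfolding hyperbolic_polys_def by blast+

lemma hyperbolic_polys_iff: "p \<in> hyperbolic_polys n \<longleftrightarrow> (\<exists>M. size M = n \<and> p = monic_of_roots M)"
proof
  assume p: "p \<in> hyperbolic_polys n"
  have "size (proots p) = degree p"
    unfolding size_proots_hyperbolic[OF p] hyperbolic_polys_D(2)[OF p] by (rule refl)
  from monic_of_roots_proots[OF hyperbolic_polys_D(1)[OF p] this]
  show "\<exists>M. size M = n \<and> p = monic_of_roots M"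
    using size_proots_hyperbolic[OF p] by metis
next
  assume "\<exists>M. size M = n \<and> p = monic_of_roots M"
  then show "p \<in> hyperbolic_polys n"
    by (elim exE conjE, hypsubst) (rule monic_of_roots_hyperbolic)
qed

lemma poly_monic_of_roots_eq_0_iff: "poly (monic_of_roots M) t = 0 \<longleftrightarrow> t \<in># M"
  by (induction M) auto

lemma poly_monic_of_roots_neg_iff:
  "poly (monic_of_roots M) t \<noteq> 0 \<Longrightarrow>
   poly (monic_of_roots M) t < 0 \<longleftrightarrow> odd (size (filter_mset (\<lambda>x. t < x) M))"
proof (induction M)
  case (add x M)
  let ?p = "poly (monic_of_roots M) t"
  have eq: "poly (monic_of_roots (add_mset x M)) t = (t - x) * ?p" by simp
  then have "?p \<noteq> 0" "t \<noteq> x" using add.prems by auto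
  then consider "t < x" | "x < t" by linarith
  then show ?case
  proof cases
    case 1
    then have "(t - x) * ?p < 0 \<longleftrightarrow> \<not> ?p < 0" using \<open>?p \<noteq> 0\<close>
      by (auto simp: mult_less_0_iff)
    then show ?thesis using add.IH \<open>?p \<noteq> 0\<close> 1 unfolding eq by simp
  next
    case 2
    then have "(t - x) * ?p < 0 \<longleftrightarrow> ?p < 0" by (auto simp: mult_less_0_iff)
    then show ?thesis using add.IH \<open>?p \<noteq> 0\<close> 2 unfolding eq by simp
  qed
qed simp

lemma coeff_monic_of_roots_subleading:
  "size M = Suc k \<Longrightarrow> coeff (monic_of_roots M) k = - sum_mset M"
proof (induction M arbitrary: k)
  case (add x M)
  have size: "size M = k" using add.prems by simp
  have "coeff ([:- x, 1:] * monic_of_roots M) k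
      = - x * coeff (monic_of_roots M) k + coeff (pCons 0 (monic_of_roots M)) k"
    by (simp add: mult_pCons_left)
  also have "coeff (monic_of_roots M) k = 1"
    using lead_coeff_monic_of_roots[of M] size by (simp only: degree_monic_of_roots)
  also have "coeff (pCons 0 (monic_of_roots M)) k = - sum_mset M"
    using add.IH size by (cases k) auto
  finally show ?case by simp
qed simp

section \<open>Roots of P + c P'\<close>

abbreviation hermite_poulain :: "real \<Rightarrow> real poly \<Rightarrow> real poly" where
  "hermite_poulain c P \<equiv> P + smult c (pderiv P)"

lemma degree_hermite_poulain [simp]: "degree (hermite_poulain c P) = degree P"
proof (cases "degree P = 0")
  case True
  then show ?thesis by (auto elim!: degree_eq_zeroE simp: pderiv_pCons)
next
  case False
  then have "degree (smult c (pderiv P)) < degree P" by (simp add: degree_pderiv)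
  then show ?thesis by (rule degree_add_eq_left)
qed

lemma lead_coeff_hermite_poulain [simp]: "lead_coeff (hermite_poulain c P) = lead_coeff P"
  by (simp only: degree_hermite_poulain) (simp add: coeff_pderiv coeff_eq_0)

lemma hermite_poulain_eq_0_iff [simp]: "hermite_poulain c P = 0 \<longleftrightarrow> P = 0"
  by (metis lead_coeff_hermite_poulain leading_coeff_0_iff)

text \<open>
  Up to a factor without zeros, \<open>P + c P'\<close> is a derivative. This is what makes Rolle's theorem
  applicable.
\<close>
lemma exp_mult_poly_deriv:
  fixes c :: real
  assumes "c \<noteq> 0"
  shows "((\<lambda>x. exp (x / c) * poly P x) has_real_derivative
          exp (x / c) / c * poly (hermite_poulain c P) x) (at x)"
  using assms by (auto intro!: derivative_eq_intros simp: field_simps)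

text \<open>
  If \<open>P\<close> has a next root, Rolle's theorem for \<open>exp (x / c) * P x\<close> gives \<open>\<rho>\<close> between the two. If \<open>r\<close> is
  the last root, suppose that \<open>P + c P'\<close> has no root beyond \<open>r\<close>. Then it is positive there, so that
  \<open>exp (x / c) * P x\<close> decreases from its value 0 at \<open>r\<close>, although \<open>P\<close> is eventually positive.
\<close>
lemma hermite_poulain_root_right_pos:
  fixes c :: real
  assumes c: "c < 0" and lc: "lead_coeff P > 0" and r: "poly P r = 0"
  shows "\<exists>\<rho>>r. poly (hermite_poulain c P) \<rho> = 0 \<and> (\<forall>s. r < s \<and> s \<le> \<rho> \<longrightarrow> poly P s \<noteq> 0)"
proof -
  let ?F = "hermite_poulain c P" and ?h = "\<lambda>x. exp (x / c) * poly P x"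
  have P0: "P \<noteq> 0" using lc by auto
  let ?R = "{x. poly P x = 0 \<and> r < x}"
  have fin: "finite ?R" by (rule finite_subset[OF _ poly_roots_finite[OF P0]]) auto
  have deriv: "(?h has_real_derivative exp (x / c) / c * poly ?F x) (at x)" for x
    using c by (intro exp_mult_poly_deriv) simp
  show ?thesis
  proof (cases "?R = {}")
    case False
    define r' where "r' = Min ?R"
    have r': "r < r'" "poly P r' = 0" using Min_in[OF fin False] by (auto simp: r'_def)
    have below: "poly P s \<noteq> 0" if "r < s" "s < r'" for s
      using Min_le[OF fin, of s] that unfolding r'_def by force
    have "\<exists>z. r < z \<and> z < r' \<and> (*) (exp (z / c) / c * poly ?F z) = (\<lambda>v. 0)"
    proof (rule Rolle_deriv[OF r'(1)])
      show "?h r = ?h r'" using r r' by simp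
      show "continuous_on {r..r'} ?h" by (intro continuous_intros) (use c in auto)
      show "(?h has_derivative (*) (exp (x / c) / c * poly ?F x)) (at x)" for x
        using deriv[of x] by (simp only: has_field_derivative_def)
    qed
    then obtain z where z: "r < z" "z < r'" "exp (z / c) / c * poly ?F z * 1 = 0"
      by metis
    then have "poly ?F z = 0" using c by simp
    then show ?thesis using z below by (intro exI[of _ z]) auto
  next
    case True
    have "\<exists>\<rho>>r. poly ?F \<rho> = 0"
    proof (rule ccontr)
      assume no: "\<not> (\<exists>\<rho>>r. poly ?F \<rho> = 0)"
      obtain N1 where N1: "\<And>x. x \<ge> N1 \<Longrightarrow> poly P x \<ge> lead_coeff P"
        using poly_pinfty_gt_lc[OF lc] by blast
      have lcF: "lead_coeff ?F > 0" using lc by (simp only: lead_coeff_hermite_poulain)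
      obtain N2 where N2: "\<And>x. x \<ge> N2 \<Longrightarrow> poly ?F x \<ge> lead_coeff ?F"
        using poly_pinfty_gt_lc[OF lcF] by blast
      have posF: "poly ?F x > 0" if "x > r" for x
      proof (rule ccontr)
        assume "\<not> poly ?F x > 0"
        then have neg: "poly ?F x < 0" using no that by force
        have pos: "poly ?F (max N2 (x + 1)) > 0" using N2[of "max N2 (x + 1)"] lcF by simp
        have "x < max N2 (x + 1)" by simp
        from poly_IVT_pos[OF this neg pos] show False using no that by auto
      qed
      define N where "N = max N1 (r + 1)"
      have "r < N" "poly P N > 0" using N1[of N] lc by (auto simp: N_def)
      have "?h N < ?h r"
      proof (rule DERIV_neg_imp_decreasing_open[OF \<open>r < N\<close>])
        fix x assume "r < x" "x < N"
        then have "exp (x / c) / c * poly ?F x < 0"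
          using posF[of x] c by (simp add: divide_neg_pos mult_neg_pos divide_less_0_iff)
        then show "\<exists>y. DERIV ?h x :> y \<and> y < 0" using deriv by blast
      next
        show "continuous_on {r..N} ?h" by (intro continuous_intros) (use c in auto)
      qed
      then show False using r \<open>poly P N > 0\<close> by (simp add: mult_less_0_iff)
    qed
    then show ?thesis using True by auto
  qed
qed

lemma hermite_poulain_root_right:
  fixes c :: real
  assumes "c < 0" "P \<noteq> 0" "poly P r = 0"
  shows "\<exists>\<rho>>r. poly (hermite_poulain c P) \<rho> = 0 \<and> (\<forall>s. r < s \<and> s \<le> \<rho> \<longrightarrow> poly P s \<noteq> 0)"
proof (cases "lead_coeff P > 0")
  case True
  then show ?thesis using hermite_poulain_root_right_pos assms by blast
next
  case False
  then have "lead_coeff (- P) > 0" using assms by (simp add: order_less_le)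
  from hermite_poulain_root_right_pos[OF assms(1) this, of r] assms
  show ?thesis by (auto simp: pderiv_minus)
qed

text \<open>
  Comparing \<open>c * x\<close> instead of \<open>x\<close> treats both signs of \<open>c\<close> at once: the new roots are displaced in
  the direction of \<open>- c\<close>. For \<open>c > 0\<close> reflect the polynomial at the origin, which reverses the sign of the
  derivative.
\<close>
lemma hermite_poulain_root_beyond:
  fixes c :: real
  assumes "c \<noteq> 0" "P \<noteq> 0" "poly P r = 0"
  shows "\<exists>\<rho>. c * \<rho> < c * r \<and> poly (hermite_poulain c P) \<rho> = 0 \<and>
             (\<forall>s. c * \<rho> \<le> c * s \<and> c * s < c * r \<longrightarrow> poly P s \<noteq> 0)"
proof (cases "c < 0")
  case True
  then show ?thesis using hermite_poulain_root_right[OF True assms(2,3)]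
    by (auto simp: mult_less_cancel_left)
next
  case False
  then have c: "c > 0" using assms by simp
  define p where "p = pcompose P [:0, -1:]"
  have p: "poly p x = poly P (- x)" for x by (simp add: p_def poly_pcompose)
  have p': "poly (pderiv p) x = - poly (pderiv P) (- x)" for x
    by (simp add: p_def pderiv_pcompose poly_pcompose pderiv_pCons)
  have "p \<noteq> 0" using assms(2) p by (metis poly_all_0_iff_0 minus_minus)
  moreover have "poly p (- r) = 0" using assms by (simp add: p)
  ultimately obtain \<rho> where \<rho>: "\<rho> > - r" "poly (hermite_poulain (- c) p) \<rho> = 0"
      "\<And>s. - r < s \<and> s \<le> \<rho> \<Longrightarrow> poly p s \<noteq> 0"
    using hermite_poulain_root_right[of "- c" p "- r"] c by auto
  show ?thesis
  proof (intro exI[of _ "- \<rho>"] conjI allI impI)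
    show "c * - \<rho> < c * r" using \<rho>(1) c by (intro mult_strict_left_mono) auto
    show "poly (hermite_poulain c P) (- \<rho>) = 0" using \<rho>(2) by (simp add: p p')
    show "poly P s \<noteq> 0" if "c * - \<rho> \<le> c * s \<and> c * s < c * r" for s
    proof -
      have "- r < - s \<and> - s \<le> \<rho>" using that c mult_le_cancel_left_pos[OF c, of "- \<rho>" s]
          mult_less_cancel_left_pos[OF c, of s r] by linarith
      then show ?thesis using \<rho>(3)[of "- s"] by (simp add: p)
    qed
  qed
qed

lemma order_hermite_poulain:
  fixes c :: real
  assumes "P \<noteq> 0" "poly P x = 0"
  shows "order x P \<le> Suc (order x (hermite_poulain c P))"
proof -
  let ?m = "order x (pderiv P)"
  have ord: "order x P = Suc ?m" using assms by (rule order_pderiv)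
  have "[:- x, 1:] ^ ?m dvd P"
    using ord by (simp add: order_divides)
  moreover have "[:- x, 1:] ^ ?m dvd smult c (pderiv P)"
    by (intro dvd_smult order_1)
  ultimately have "[:- x, 1:] ^ ?m dvd hermite_poulain c P"
    by (rule dvd_add)
  then show ?thesis using ord assms by (simp add: order_divides)
qed

text \<open>
  A root of \<open>P\<close> of multiplicity \<open>k\<close> is still a root of \<open>P + c P'\<close> of multiplicity at least \<open>k - 1\<close>. An
  injective choice \<open>\<rho>\<close> of new roots makes good for one lost unit of multiplicity per element of \<open>S0\<close>.
\<close>
lemma count_roots_hermite_poulain_ge:
  fixes c :: real
  assumes P0: "P \<noteq> 0" and S: "S = {x. poly P x = 0 \<and> I x}" and S0: "S0 \<subseteq> S"
    and \<rho>: "\<And>r. r \<in> S0 \<Longrightarrow> poly (hermite_poulain c P) (\<rho> r) = 0 \<and> poly P (\<rho> r) \<noteq> 0 \<and> I (\<rho> r)"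
    and inj: "inj_on \<rho> S0"
  shows "size (filter_mset I (proots P)) + card S0
       \<le> size (filter_mset I (proots (hermite_poulain c P))) + card S"
proof -
  let ?F = "hermite_poulain c P"
  have finS: "finite S" unfolding S by (rule finite_subset[OF _ poly_roots_finite[OF P0]]) auto
  then have fin0: "finite S0" using S0 finite_subset by blast
  have F0: "?F \<noteq> 0" using P0 by simp
  have sub: "mset_set S \<subseteq># filter_mset I (proots P)"
  proof (rule mset_subset_eqI)
    show "count (mset_set S) x \<le> count (filter_mset I (proots P)) x" for x
      using P0 finS order_root[of P x] by (auto simp: count_mset_set' S)
  qed
  have "(filter_mset I (proots P) - mset_set S) + mset_set (\<rho> ` S0) \<subseteq># filter_mset I (proots ?F)"
  proof (rule mset_subset_eqI)
    fix x
    show "count (filter_mset I (proots P) - mset_set S + mset_set (\<rho> ` S0)) x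
        \<le> count (filter_mset I (proots ?F)) x"
    proof (cases "x \<in> \<rho> ` S0")
      case True
      then have "poly ?F x = 0" "poly P x \<noteq> 0" "I x" using \<rho> by auto
      then have "order x ?F \<noteq> 0" "order x P = 0" using F0 P0 by (meson order_root)+
      then show ?thesis using True F0 P0 fin0 \<open>I x\<close> by (simp add: count_mset_set')
    next
      case False
      show ?thesis
      proof (cases "x \<in> S")
        case True
        then have "poly P x = 0" "I x" by (auto simp: S)
        then show ?thesis using order_hermite_poulain[OF P0, of x c] True False F0 P0 fin0 finS
          by (simp add: count_mset_set')
      next
        case False
        then show ?thesis using \<open>x \<notin> \<rho> ` S0\<close> F0 P0 finS fin0 order_root[of P x]
          by (auto simp: count_mset_set' S)
      qed
    qed
  qed
  from size_mset_mono[OF this]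
  have "size (filter_mset I (proots P)) - card S + card S0 \<le> size (filter_mset I (proots ?F))"
    unfolding size_union size_Diff_submset[OF sub] size_mset_set
    using card_image[OF inj] by simp
  moreover have "card S \<le> size (filter_mset I (proots P))" using size_mset_mono[OF sub] by simp
  ultimately show ?thesis by linarith
qed

context
  fixes c :: real and P :: "real poly"
  assumes c0: "c \<noteq> 0" and P0: "P \<noteq> 0"
begin

text \<open>
  Distinct roots get distinct partners because no root of \<open>P\<close> separates a root from its partner.
\<close>
lemma hermite_poulain_root_choice:
  obtains \<rho> where "\<And>r. poly P r = 0 \<Longrightarrow> c * \<rho> r < c * r"
    "\<And>r. poly P r = 0 \<Longrightarrow> poly (hermite_poulain c P) (\<rho> r) = 0"
    "\<And>r s. poly P r = 0 \<Longrightarrow> c * \<rho> r \<le> c * s \<Longrightarrow> c * s < c * r \<Longrightarrow> poly P s \<noteq> 0"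
    "inj_on \<rho> {r. poly P r = 0}"
proof -
  have "\<forall>r. \<exists>\<rho>. poly P r = 0 \<longrightarrow> c * \<rho> < c * r \<and> poly (hermite_poulain c P) \<rho> = 0 \<and>
             (\<forall>s. c * \<rho> \<le> c * s \<and> c * s < c * r \<longrightarrow> poly P s \<noteq> 0)"
    using hermite_poulain_root_beyond[OF c0 P0] by blast
  then obtain \<rho> where \<rho>: "\<And>r. poly P r = 0 \<Longrightarrow> c * \<rho> r < c * r"
    "\<And>r. poly P r = 0 \<Longrightarrow> poly (hermite_poulain c P) (\<rho> r) = 0"
    "\<And>r s. poly P r = 0 \<Longrightarrow> c * \<rho> r \<le> c * s \<Longrightarrow> c * s < c * r \<Longrightarrow> poly P s \<noteq> 0"
    by metis
  have "inj_on \<rho> {r. poly P r = 0}"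
  proof (rule inj_onI, clarify)
    fix r s assume rs: "poly P r = 0" "poly P s = 0" "\<rho> r = \<rho> s"
    have "\<not> c * r < c * s" "\<not> c * s < c * r"
      using \<rho>(1)[OF rs(1)] \<rho>(1)[OF rs(2)] \<rho>(3)[OF rs(1), of s] \<rho>(3)[OF rs(2), of r] rs by auto
    then show "r = s" using c0 by (metis linorder_neqE mult_cancel_left)
  qed
  with \<rho> show ?thesis by (rule that)
qed

lemma count_roots_downward:
  assumes I: "\<And>x y. I x \<Longrightarrow> c * y < c * x \<Longrightarrow> I y"
  shows "size (filter_mset I (proots P)) \<le> size (filter_mset I (proots (hermite_poulain c P)))"
proof -
  obtain \<rho> where \<rho>: "\<And>r. poly P r = 0 \<Longrightarrow> c * \<rho> r < c * r"
    "\<And>r. poly P r = 0 \<Longrightarrow> poly (hermite_poulain c P) (\<rho> r) = 0"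
    "\<And>r s. poly P r = 0 \<Longrightarrow> c * \<rho> r \<le> c * s \<Longrightarrow> c * s < c * r \<Longrightarrow> poly P s \<noteq> 0"
    "inj_on \<rho> {r. poly P r = 0}"
    by (rule hermite_poulain_root_choice) blast
  let ?S = "{x. poly P x = 0 \<and> I x}"
  have "inj_on \<rho> ?S" by (rule inj_on_subset[OF \<rho>(4)]) auto
  moreover have "poly (hermite_poulain c P) (\<rho> r) = 0 \<and> poly P (\<rho> r) \<noteq> 0 \<and> I (\<rho> r)"
    if "r \<in> ?S" for r
    using that \<rho>(1)[of r] \<rho>(2)[of r] \<rho>(3)[of r "\<rho> r"] I[of r "\<rho> r"] by simp
  ultimately show ?thesis
    using count_roots_hermite_poulain_ge[OF P0 refl subset_refl, of I c \<rho>] by simp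
qed

text \<open>
  Among the roots \<open>r\<close> with \<open>c * t \<le> c * r\<close> only the one closest to \<open>t\<close> can have its partner on the other
  side of \<open>t\<close>; the partner of any other one does not jump over the closest one.
\<close>
lemma count_roots_upward:
  "size (filter_mset (\<lambda>x. c * t \<le> c * x) (proots P))
   \<le> Suc (size (filter_mset (\<lambda>x. c * t \<le> c * x) (proots (hermite_poulain c P))))"
proof -
  obtain \<rho> where \<rho>: "\<And>r. poly P r = 0 \<Longrightarrow> c * \<rho> r < c * r"
    "\<And>r. poly P r = 0 \<Longrightarrow> poly (hermite_poulain c P) (\<rho> r) = 0"
    "\<And>r s. poly P r = 0 \<Longrightarrow> c * \<rho> r \<le> c * s \<Longrightarrow> c * s < c * r \<Longrightarrow> poly P s \<noteq> 0"
    "inj_on \<rho> {r. poly P r = 0}"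
    by (rule hermite_poulain_root_choice) blast
  define S where "S = {x. poly P x = 0 \<and> c * t \<le> c * x}"
  have finS: "finite S" unfolding S_def by (rule finite_subset[OF _ poly_roots_finite[OF P0]]) auto
  show ?thesis
  proof (cases "S = {}")
    case True
    then have none: "filter_mset (\<lambda>x. c * t \<le> c * x) (proots P) = {#}"
      using P0 by (intro multiset_eqI) (auto simp: S_def intro!: order_0I)
    show ?thesis unfolding none by simp
  next
    case False
    then have ne: "(*) c ` S \<noteq> {}" by simp
    obtain r0 where r0: "r0 \<in> S" "\<And>r. r \<in> S \<Longrightarrow> c * r0 \<le> c * r"
    proof -
      have "Min ((*) c ` S) \<in> (*) c ` S" using finS ne by (intro Min_in) auto
      then obtain r0 where "r0 \<in> S" "c * r0 = Min ((*) c ` S)" by auto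
      then show ?thesis using finS by (intro that[of r0]) (auto intro!: Min_le)
    qed
    let ?S0 = "S - {r0}"
    have inj: "inj_on \<rho> ?S0" by (rule inj_on_subset[OF \<rho>(4)]) (auto simp: S_def)
    have "poly (hermite_poulain c P) (\<rho> r) = 0 \<and> poly P (\<rho> r) \<noteq> 0 \<and> c * t \<le> c * \<rho> r"
      if "r \<in> ?S0" for r
    proof -
      have r: "poly P r = 0" using that by (auto simp: S_def)
      have lt: "c * r0 < c * r" using r0(2)[of r] that c0 by (auto simp: less_le)
      have "\<not> c * \<rho> r \<le> c * r0" using \<rho>(3)[OF r _ lt] r0(1) by (auto simp: S_def)
      then have "c * t \<le> c * \<rho> r" using r0(1) by (auto simp: S_def)
      then show ?thesis using \<rho>(1)[OF r] \<rho>(2)[OF r] \<rho>(3)[OF r, of "\<rho> r"] by auto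
    qed
    from count_roots_hermite_poulain_ge[OF P0 S_def _ this inj]
    show ?thesis using finS r0(1) card_gt_0_iff[of S] by (auto simp: card_Diff_singleton)
  qed
qed

text \<open>
  The Hermite--Poulain theorem: the partners of the roots of \<open>P\<close>, together with the roots left over from
  multiple ones, already exhaust the degree.
\<close>
lemma size_proots_hermite_poulain:
  assumes "size (proots P) = degree P"
  shows "size (proots (hermite_poulain c P)) = degree P"
proof (rule antisym)
  show "size (proots (hermite_poulain c P)) \<le> degree P"
    using size_proots_le[of "hermite_poulain c P"] by simp
  show "degree P \<le> size (proots (hermite_poulain c P))"
    using count_roots_downward[of "\<lambda>_. True"] assms by simp
qed

end

lemma hermite_poulain_hyperbolic:
  assumes "P \<in> hyperbolic_polys n"
  shows "hermite_poulain c P \<in> hyperbolic_polys n"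
proof (cases "c = 0")
  case False
  note lc = hyperbolic_polys_D(1)[OF assms] and deg = hyperbolic_polys_D(2)[OF assms]
  have "P \<noteq> 0" using lc by (metis leading_coeff_0_iff zero_neq_one)
  have "size (proots P) = degree P" using size_proots_hyperbolic[OF assms] deg by simp
  then have size: "size (proots (hermite_poulain c P)) = degree P"
    using size_proots_hermite_poulain[OF False \<open>P \<noteq> 0\<close>] by blast
  have "monic_of_roots (proots (hermite_poulain c P)) = hermite_poulain c P"
  proof (rule monic_of_roots_proots)
    show "lead_coeff (hermite_poulain c P) = 1"
      using lc by (simp only: lead_coeff_hermite_poulain)
    show "size (proots (hermite_poulain c P)) = degree (hermite_poulain c P)"
      using size by (simp only: degree_hermite_poulain)
  qed
  with size deg show ?thesis unfolding hyperbolic_polys_iff by metis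
qed (use assms in simp)

text \<open>
  The position of the new roots is determined by a sign. By \<open>count_roots_downward\<close> and
  \<open>count_roots_upward\<close> at most one further root is found beyond \<open>t\<close> (in the direction of \<open>- c\<close>), and parity decides whether it is: the sign
  of a monic real-rooted polynomial at \<open>t\<close> is given by the parity of the number of larger roots.
\<close>
lemma count_roots_hermite_poulain:
  fixes c :: real
  assumes c0: "c \<noteq> 0" and P: "P \<in> hyperbolic_polys n"
    and t: "poly P t \<noteq> 0" "poly (hermite_poulain c P) t \<noteq> 0"
  shows "size (filter_mset (\<lambda>x. c * x < c * t) (proots (hermite_poulain c P)))
       = size (filter_mset (\<lambda>x. c * x < c * t) (proots P))
         + (if poly P t * poly (hermite_poulain c P) t < 0 then 1 else 0)"
proof -
  let ?F = "hermite_poulain c P"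
  let ?L = "\<lambda>M. size (filter_mset (\<lambda>x. c * x < c * t) M)"
  let ?U = "\<lambda>M. size (filter_mset (\<lambda>x. c * t \<le> c * x) M)"
  let ?N = "\<lambda>M. size (filter_mset (\<lambda>x. t < x) M)"
  have F: "?F \<in> hyperbolic_polys n" by (rule hermite_poulain_hyperbolic[OF P])
  obtain A B where A: "size A = n" "P = monic_of_roots A" and B: "size B = n" "?F = monic_of_roots B"
    using P F unfolding hyperbolic_polys_iff by blast
  have rts: "proots P = A" "proots ?F = B"
    using arg_cong[OF A(2), of proots] arg_cong[OF B(2), of proots]
    by (simp_all only: proots_monic_of_roots)
  have P0: "P \<noteq> 0" using t by auto
  have split: "?L M + ?U M = size M" for M
    by (induction M) auto
  have lower: "?L A \<le> ?L B"
    using count_roots_downward[OF c0 P0, of "\<lambda>x. c * x < c * t"] rts by simp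
  have upper: "?U A \<le> Suc (?U B)"
    using count_roots_upward[OF c0 P0, of t] rts by simp
  have step: "?L B = ?L A \<or> ?L B = Suc (?L A)"
    using lower upper split[of A] split[of B] A(1) B(1) by linarith
  have parity: "even (?L M + ?N M) \<longleftrightarrow> c < 0 \<or> even (size M)" if "t \<notin># M" for M
  proof (cases "c < 0")
    case True
    then have "?L M = ?N M" by (simp add: mult_less_cancel_left)
    then show ?thesis using True by simp
  next
    case False
    have "?L M + ?N M = size M" using False c0 that
      by (induction M) (auto simp: mult_less_cancel_left)
    then show ?thesis using False by simp
  qed
  have tA: "t \<notin># A" and tB: "t \<notin># B"
    using t unfolding B(2) unfolding A(2) poly_monic_of_roots_eq_0_iff by auto
  have "even (?L A + ?L B) \<longleftrightarrow> even (?N A + ?N B)"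
    using parity[OF tA] parity[OF tB] A(1) B(1) by (auto)
  also have "\<dots> \<longleftrightarrow> (poly P t < 0 \<longleftrightarrow> poly ?F t < 0)"
    using t poly_monic_of_roots_neg_iff[of A t] poly_monic_of_roots_neg_iff[of B t]
    unfolding B(2)[symmetric] A(2)[symmetric] by auto
  also have "\<dots> \<longleftrightarrow> \<not> poly P t * poly ?F t < 0"
    using t by (auto simp: mult_less_0_iff)
  finally show ?thesis using step unfolding rts by auto
qed

section \<open>The effect of a pinch\<close>

text \<open>
  In terms of \<open>1 / D\<close>, the sign in question is that of \<open>u + v / D\<close>; where \<open>D\<close> and \<open>D'\<close> have the same sign,
  \<open>D \<le> D'\<close> means \<open>1 / D' \<le> 1 / D\<close>.
\<close>
lemma scaled_sign_mono:
  fixes D D' u v :: real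
  assumes neg: "D' * (D' * u + v) < 0" and "v \<le> 0" "0 < D * D'" "D \<le> D'"
  shows "D * (D * u + v) < 0"
proof (cases "D' > 0")
  case True
  then have D: "D > 0" using assms by (simp add: zero_less_mult_iff)
  have "D' * u + v < 0" using neg True by (simp add: mult_less_0_iff)
  moreover have "D * u \<le> D' * u" if "u \<ge> 0" using that assms by (intro mult_right_mono)
  moreover have "D * u < 0" if "u < 0" using that D by (simp add: mult_less_0_iff)
  ultimately have "D * u + v < 0" using assms by (cases "u \<ge> 0") auto
  then show ?thesis using D by (simp add: mult_less_0_iff)
next
  case False
  then have D': "D' < 0" using neg by (cases "D' = 0") auto
  then have D: "D < 0" using assms by (simp add: zero_less_mult_iff)
  have "D' * u + v > 0" using neg D' by (simp add: mult_less_0_iff)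
  then have "u < 0" using D' assms by (smt (verit) mult_nonneg_nonpos2 mult_nonpos_nonneg)
  then have "D * u \<ge> D' * u" using assms by (intro mult_right_mono_neg) auto
  then have "D * u + v > 0" using \<open>D' * u + v > 0\<close> by linarith
  then show ?thesis using D by (simp add: mult_less_0_iff)
qed

lemma poly_hermite_poulain_linear_factor:
  fixes c :: real
  shows "poly (hermite_poulain c ([:- a, 1:] * R)) t
       = (t - a) * poly (hermite_poulain c R) t + c * poly R t"
proof -
  have pd: "pderiv ([:- a, 1:] * R) = [:- a, 1:] * pderiv R + R"
    by (simp only: pderiv_mult) (simp add: pderiv_pCons)
  show ?thesis unfolding pd poly_add poly_smult poly_mult by (simp add: algebra_simps)
qed

text \<open>
  Only the product \<open>(t - a) * (t - b)\<close> and the sum \<open>a + b\<close> of two chosen roots enter the sign. A pinch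
  preserves the sum, so it acts through the product alone.
\<close>
lemma poly_hermite_poulain_two_roots:
  fixes c :: real
  assumes "Q = [:- a, 1:] * ([:- b, 1:] * R)"
  shows "poly Q t * poly (hermite_poulain c Q) t
       = ((t - a) * (t - b)) * (((t - a) * (t - b)) * (poly R t * poly (hermite_poulain c R) t)
          + c * (2 * t - (a + b)) * (poly R t)\<^sup>2)"
  unfolding assms poly_hermite_poulain_linear_factor
  by (simp add: power2_eq_square algebra_simps)

text \<open>
  The heart of the argument. Let \<open>m = (a + b) / 2\<close>. For \<open>t\<close> on one side of \<open>m\<close> only one of the two moving
  roots, \<open>a\<close> or \<open>b\<close>, can pass through \<open>t\<close>. If it does, the count for \<open>P\<close> itself changes by one in the
  asserted direction, which makes up for the correction by 0 or 1 for the new roots. If it does not,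
  \<open>(t - a) * (t - b)\<close> keeps its sign under the pinch and does not decrease, so the sign criterion for the
  correction is monotone, in a direction that depends on the side of \<open>m\<close> on which \<open>t\<close> lies.
\<close>
lemma pinch_count:
  fixes c :: real
  assumes c0: "c \<noteq> 0"
    and ord: "c * a \<le> c * a'" "c * a' \<le> c * b'" "c * b' \<le> c * b" and sum: "a' + b' = a + b"
    and P: "P = monic_of_roots ({#a', b'#} + M)" and Q: "Q = monic_of_roots ({#a, b#} + M)"
    and nz: "poly P t \<noteq> 0" "poly (hermite_poulain c P) t \<noteq> 0"
            "poly Q t \<noteq> 0" "poly (hermite_poulain c Q) t \<noteq> 0"
  defines "L \<equiv> \<lambda>p. size (filter_mset (\<lambda>x. c * x < c * t) (proots (hermite_poulain c p)))"
  shows "c * (2 * t - (a + b)) < 0 \<Longrightarrow> L P \<le> L Q"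
    and "c * (2 * t - (a + b)) > 0 \<Longrightarrow> L Q \<le> L P"
proof -
  define R where "R = monic_of_roots M"
  define k where "k = c * (2 * t - (a + b))"
  define D where "D = (t - a) * (t - b)"
  define D' where "D' = (t - a') * (t - b')"
  define u where "u = poly R t * poly (hermite_poulain c R) t"
  define s where "s = (poly R t)\<^sup>2"
  let ?L = "\<lambda>M. size (filter_mset (\<lambda>x. c * x < c * t) M)"
  have Pf: "P = [:- a', 1:] * ([:- b', 1:] * R)" and Qf: "Q = [:- a, 1:] * ([:- b, 1:] * R)"
    unfolding P Q R_def by simp_all
  have signP: "poly P t * poly (hermite_poulain c P) t = D' * (D' * u + k * s)"
    unfolding poly_hermite_poulain_two_roots[OF Pf] D'_def u_def k_def s_def sum by simp
  have signQ: "poly Q t * poly (hermite_poulain c Q) t = D * (D * u + k * s)"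
    unfolding poly_hermite_poulain_two_roots[OF Qf] D_def u_def k_def s_def by simp
  have hypP: "P \<in> hyperbolic_polys (size M + 2)" and hypQ: "Q \<in> hyperbolic_polys (size M + 2)"
    using monic_of_roots_hyperbolic[of "{#a', b'#} + M"] monic_of_roots_hyperbolic[of "{#a, b#} + M"]
    unfolding P Q by simp_all
  have LP: "L P = ?L M + (if c * a' < c * t then 1 else 0) + (if c * b' < c * t then 1 else 0)
                  + (if D' * (D' * u + k * s) < 0 then 1 else 0)"
    unfolding L_def count_roots_hermite_poulain[OF c0 hypP nz(1,2)] signP
    unfolding P proots_monic_of_roots by simp
  have LQ: "L Q = ?L M + (if c * a < c * t then 1 else 0) + (if c * b < c * t then 1 else 0)
                  + (if D * (D * u + k * s) < 0 then 1 else 0)"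
    unfolding L_def count_roots_hermite_poulain[OF c0 hypQ nz(3,4)] signQ
    unfolding Q proots_monic_of_roots by simp
  have ne: "t \<noteq> a" "t \<noteq> b" "t \<noteq> a'" "t \<noteq> b'" using nz(1,3) unfolding Pf Qf by auto
  then have cne: "c * t \<noteq> c * a" "c * t \<noteq> c * b" "c * t \<noteq> c * a'" "c * t \<noteq> c * b'" using c0 by auto
  have csum: "c * a' + c * b' = c * a + c * b" using sum by (metis distrib_left)
  \<comment> \<open>The two roots have the same sum and are closer together, so the product
     of their signed distances to t does not decrease;
     the scaling by the square of c serves to use the ordering, which is given for the scaled roots.\<close>
  have DD': "D \<le> D'"
  proof -
    have "D' - D = (a' - a) * (b - a')"
    proof -
      have b': "b' = a + b - a'" using sum by simp
      show ?thesis unfolding D_def D'_def b' by (simp add: algebra_simps)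
    qed
    also have "c\<^sup>2 * \<dots> = (c * a' - c * a) * (c * b - c * a')"
      by (simp add: power2_eq_square algebra_simps)
    finally have "c\<^sup>2 * (D' - D) = (c * a' - c * a) * (c * b - c * a')" .
    moreover have "\<dots> \<ge> 0" using ord by (intro mult_nonneg_nonneg) auto
    ultimately have "c\<^sup>2 * (D' - D) \<ge> 0" by simp
    then show ?thesis using c0 by (simp add: zero_le_mult_iff)
  qed
  have cD: "c\<^sup>2 * D = (c * t - c * a) * (c * t - c * b)" and cD': "c\<^sup>2 * D' = (c * t - c * a') * (c * t - c * b')"
    by (simp_all add: D_def D'_def power2_eq_square algebra_simps)
  have c2: "c\<^sup>2 > 0" using c0 by simp
  have k2: "k = 2 * (c * t) - (c * a + c * b)" by (simp add: k_def algebra_simps)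
  have same: "0 < D * D'" if "(D < 0) = (D' < 0)"
  proof -
    have "D \<noteq> 0" "D' \<noteq> 0" using ne by (auto simp: D_def D'_def)
    then show ?thesis using that by (auto simp: zero_less_mult_iff)
  qed
  have Dneg: "D < 0 \<longleftrightarrow> (c * t - c * a) * (c * t - c * b) < 0"
    and D'neg: "D' < 0 \<longleftrightarrow> (c * t - c * a') * (c * t - c * b') < 0"
    unfolding cD[symmetric] cD'[symmetric] using c2 by (auto simp: mult_less_0_iff)
  show "L P \<le> L Q" if "c * (2 * t - (a + b)) < 0"
  proof -
    have k: "k < 0" using that by (simp add: k_def)
    have tb: "c * t < c * b'" "c * t < c * b" using k k2 csum ord by linarith+
    show ?thesis
    proof (cases "c * a < c * t \<and> c * t < c * a'")
      case True
      then show ?thesis unfolding LP LQ using tb ord by auto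
    next
      case False
      have outside: "c * t < c * a \<or> c * a' < c * t" using False cne ord by linarith
      have "D * (D * u + k * s) < 0" if "D' * (D' * u + k * s) < 0"
      proof (rule scaled_sign_mono[OF that _ same DD'])
        show "k * s \<le> 0" using k by (simp add: s_def mult_nonpos_nonneg)
        show "(D < 0) = (D' < 0)"
          unfolding Dneg D'neg mult_less_0_iff using outside tb ord by linarith
      qed
      then show ?thesis unfolding LP LQ using tb ord False by auto
    qed
  qed
  show "L Q \<le> L P" if "c * (2 * t - (a + b)) > 0"
  proof -
    have k: "k > 0" using that by (simp add: k_def)
    have ta: "c * t > c * a'" "c * t > c * a" using k k2 csum ord by linarith+
    show ?thesis
    proof (cases "c * b' < c * t \<and> c * t < c * b")
      case True
      then show ?thesis unfolding LP LQ using ta ord by auto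
    next
      case False
      have outside: "c * t < c * b' \<or> c * b < c * t" using False cne ord by linarith
      \<comment> \<open>For k > 0 the comparison is applied with the negated quantities, which exchanges D and D'.\<close>
      have "(- D') * (- D' * u + - (k * s)) < 0" if "D * (D * u + k * s) < 0"
      proof (rule scaled_sign_mono[of "- D"])
        show "- D * (- D * u + - (k * s)) < 0" using that by (simp add: algebra_simps)
        show "- (k * s) \<le> 0" using k by (simp add: s_def)
        have "(D < 0) = (D' < 0)"
          unfolding Dneg D'neg mult_less_0_iff using outside ta ord by linarith
        from same[OF this] show "0 < - D' * - D" by (simp add: mult.commute)
      qed (use DD' in simp)
      then have "D' * (D' * u + k * s) < 0" if "D * (D * u + k * s) < 0"
        using that by (simp add: algebra_simps)
      then show ?thesis unfolding LP LQ using ta ord False by auto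
    qed
  qed
qed

text \<open>
  The sum of the roots is read off from the second highest coefficient.
\<close>
lemma sum_roots_hermite_poulain:
  "sum_mset (proots (hermite_poulain c (monic_of_roots M))) = sum_mset M - c * size M"
proof (cases "size M")
  case 0
  then show ?thesis by simp
next
  case (Suc k)
  let ?p = "monic_of_roots M"
  obtain B where B: "size B = size M" "hermite_poulain c ?p = monic_of_roots B"
    using hermite_poulain_hyperbolic[OF monic_of_roots_hyperbolic[of M], of c]
    unfolding hyperbolic_polys_iff by blast
  have lc: "coeff ?p (Suc k) = 1"
    using lead_coeff_monic_of_roots[of M] Suc by (simp only: degree_monic_of_roots)
  have "- sum_mset B = coeff (hermite_poulain c ?p) k"
    unfolding B(2) using coeff_monic_of_roots_subleading[of B k] B(1) Suc by simp
  also have "\<dots> = coeff ?p k + c * (real (Suc k) * coeff ?p (Suc k))"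
    by (simp only: coeff_add coeff_smult coeff_pderiv)
  also have "\<dots> = - sum_mset M + c * size M"
    unfolding lc coeff_monic_of_roots_subleading[OF Suc] Suc by simp
  finally show ?thesis unfolding B(2) proots_monic_of_roots by simp
qed

text \<open>
  The counts of the new roots cross only at the common midpoint of the pinched pair. It remains to
  translate from the direction of \<open>- c\<close> to roots larger than \<open>t\<close>, which for \<open>c > 0\<close> means passing to
  complementary counts.
\<close>
lemma hermite_poulain_pinch_majorized:
  fixes c :: real
  assumes c0: "c \<noteq> 0" and ord: "a \<le> a'" "a' \<le> b'" "b' \<le> b" and sum: "a' + b' = a + b"
  shows "proots (hermite_poulain c (monic_of_roots ({#a', b'#} + M)))
      \<prec>\<^sub>m proots (hermite_poulain c (monic_of_roots ({#a, b#} + M)))"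
proof -
  define P where "P = monic_of_roots ({#a', b'#} + M)"
  define Q where "Q = monic_of_roots ({#a, b#} + M)"
  let ?W = "proots (hermite_poulain c P)" and ?U = "proots (hermite_poulain c Q)"
  let ?L = "\<lambda>t p. size (filter_mset (\<lambda>x. c * x < c * t) (proots (hermite_poulain c p)))"
  let ?N = "\<lambda>t p. size (filter_mset (\<lambda>x. t < x) (proots (hermite_poulain c p)))"
  define E where "E = {t. poly P t = 0} \<union> {t. poly (hermite_poulain c P) t = 0}
                    \<union> {t. poly Q t = 0} \<union> {t. poly (hermite_poulain c Q) t = 0}"
  have nz: "P \<noteq> 0" "Q \<noteq> 0" unfolding P_def Q_def by (rule monic_of_roots_nz)+
  then have nz': "hermite_poulain c P \<noteq> 0" "hermite_poulain c Q \<noteq> 0" by simp_all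
  have finE: "finite E" unfolding E_def by (intro finite_UnI poly_roots_finite nz nz')
  have hyp: "hermite_poulain c P \<in> hyperbolic_polys (size M + 2)"
    "hermite_poulain c Q \<in> hyperbolic_polys (size M + 2)"
    unfolding P_def Q_def
    using monic_of_roots_hyperbolic[of "{#a', b'#} + M"] monic_of_roots_hyperbolic[of "{#a, b#} + M"]
    by (simp_all add: hermite_poulain_hyperbolic)
  have sizeW: "size ?W = size M + 2" and sizeU: "size ?U = size M + 2"
    by (rule size_proots_hyperbolic[OF hyp(1)] size_proots_hyperbolic[OF hyp(2)])+
  have L: "(c * (2 * t - (a + b)) < 0 \<longrightarrow> ?L t P \<le> ?L t Q) \<and>
           (c * (2 * t - (a + b)) > 0 \<longrightarrow> ?L t Q \<le> ?L t P)" if "t \<notin> E" for t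
  proof -
    have t: "poly P t \<noteq> 0" "poly (hermite_poulain c P) t \<noteq> 0"
            "poly Q t \<noteq> 0" "poly (hermite_poulain c Q) t \<noteq> 0"
      using that unfolding E_def by blast+
    show ?thesis
    proof (cases "c > 0")
      case True
      then have "c * a \<le> c * a'" "c * a' \<le> c * b'" "c * b' \<le> c * b" using ord by simp_all
      from pinch_count[OF c0 this sum P_def Q_def t] show ?thesis by blast
    next
      case False
      then have "c * b \<le> c * b'" "c * b' \<le> c * a'" "c * a' \<le> c * a"
        using ord by (simp_all add: mult_left_mono_neg)
      moreover have "b' + a' = b + a" using sum by simp
      \<comment> \<open>For negative c, multiplication by c reverses the order of the four roots.\<close>
      moreover have "P = monic_of_roots ({#b', a'#} + M)" "Q = monic_of_roots ({#b, a#} + M)"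
        unfolding P_def Q_def by (simp_all only: add_mset_commute[of a'] add_mset_commute[of a])
      ultimately show ?thesis
        using pinch_count[OF c0 _ _ _ _ _ _ t, of b b' a' a] by (simp only: add.commute[of b a]) blast
    qed
  qed
  have LN: "?L t p = ?N t p" if "c < 0" for t p
    using that by (simp add: mult_less_cancel_left)
  have LN': "?L t p + ?N t p = size (proots (hermite_poulain c p))"
    if "c > 0" "poly (hermite_poulain c p) t \<noteq> 0" "hermite_poulain c p \<noteq> 0" for t p
  proof -
    have "t \<notin># proots (hermite_poulain c p)" using that(2,3) by simp
    then have "size (filter_mset (\<lambda>x. c * x < c * t) B) + size (filter_mset (\<lambda>x. t < x) B) = size B"
      if "B = proots (hermite_poulain c p)" for B
      unfolding that[symmetric] using \<open>c > 0\<close> by (induction B) (auto simp: mult_less_cancel_left)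
    then show ?thesis by blast
  qed
  have "?W \<prec>\<^sub>m ?U"
  proof (rule majorized_if_single_crossing[where m = "(a + b) / 2", OF _ _ finE])
    show "size ?W = size ?U" using sizeW sizeU by simp
    show "sum_mset ?W = sum_mset ?U"
      unfolding P_def Q_def sum_roots_hermite_poulain using sum by simp
    show "?N t P \<le> ?N t Q" if t: "t \<notin> E" "(a + b) / 2 < t" for t
    proof (cases "c < 0")
      case True
      then have "c * (2 * t - (a + b)) < 0" using t(2) by (simp add: mult_neg_pos)
      then show ?thesis using L[OF t(1)] LN[OF True] by simp
    next
      case False
      then have c: "c > 0" using c0 by simp
      have "c * (2 * t - (a + b)) > 0" using t(2) c by (intro mult_pos_pos) auto
      then have "?L t Q \<le> ?L t P" using L[OF t(1)] by blast
      then show ?thesis using LN'[OF c _ nz'(1), of t] LN'[OF c _ nz'(2), of t] t(1) sizeW sizeU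
        unfolding E_def by simp
    qed
    show "?N t Q \<le> ?N t P" if t: "t \<notin> E" "t < (a + b) / 2" for t
    proof (cases "c < 0")
      case True
      then have "c * (2 * t - (a + b)) > 0" using t(2) by (intro mult_neg_neg) auto
      then show ?thesis using L[OF t(1)] LN[OF True] by simp
    next
      case False
      then have c: "c > 0" using c0 by simp
      have "c * (2 * t - (a + b)) < 0" using t(2) c by (intro mult_pos_neg) auto
      then have "?L t P \<le> ?L t Q" using L[OF t(1)] by blast
      then show ?thesis using LN'[OF c _ nz'(1), of t] LN'[OF c _ nz'(2), of t] t(1) sizeW sizeU
        unfolding E_def by simp
    qed
  qed
  then show ?thesis unfolding P_def Q_def .
qed

theorem theorem2:
  fixes n :: nat and P Q :: "real poly" and c :: real
  assumes "n \<ge> 1"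
    and "P \<in> hyperbolic_polys n" and "Q \<in> hyperbolic_polys n"
    and "spectral_le n P Q"
  shows "spectral_le n (P + smult c (pderiv P)) (Q + smult c (pderiv Q))"
proof (cases "c = 0")
  case True
  then show ?thesis using assms(4) by simp
next
  case False
  obtain X where X: "P = monic_of_roots X" using assms(2) unfolding hyperbolic_polys_iff by blast
  obtain Y where Y: "Q = monic_of_roots Y" using assms(3) unfolding hyperbolic_polys_iff by blast
  have "X \<prec>\<^sub>m Y" using assms(4) unfolding spectral_le_def X Y proots_monic_of_roots by blast
  then have "proots (hermite_poulain c (monic_of_roots X)) \<prec>\<^sub>m proots (hermite_poulain c (monic_of_roots Y))"
  proof (rule majorized_pinch_induct)
    fix a b a' b' :: real and M
    assume "a \<le> a'" "a' \<le> b'" "b' \<le> b" "a' + b' = a + b"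
    then show "proots (hermite_poulain c (monic_of_roots ({#a', b'#} + M)))
            \<prec>\<^sub>m proots (hermite_poulain c (monic_of_roots ({#a, b#} + M)))"
      by (rule hermite_poulain_pinch_majorized[OF False])
  qed (blast intro: majorized_refl majorized_trans)+
  then show ?thesis
    unfolding spectral_le_def X[symmetric] Y[symmetric]
    using hermite_poulain_hyperbolic[OF assms(2)] hermite_poulain_hyperbolic[OF assms(3)] by blast
qed

end
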